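(* Let $(\eta_t)_{t\ge 0}$ be the exclusion process on $\Omega=\{0,1\}^S$, $S=\mathbb{Z}^d$, with generator $$\mathcal{L} f(\eta)=\sum_{x,y\in S}\eta(x)(1-\eta(y))\Gamma_\eta(x,y)\bigl[f(\eta^{x,y})-f(\eta)\bigr].$$ This process is monotone if and only if, for every pair of configurations $(\xi,\zeta)\in\Omega^2$ such that $\xi\le\zeta$, the following inequalities hold: (i) for all $y\in S$ such that $\zeta(y)=0$, $$\sum_{x\in S}\xi(x)\bigl[\Gamma_\xi(x,y)-\Gamma_\zeta(x,y)\bigr]^+\le\sum_{x\in S}\zeta(x)(1-\xi(x))\Gamma_\zeta(x,y);$$ (ii) for all $x\in S$ such that $\xi(x)=1$, $$\sum_{y\in S}(1-\zeta(y))\bigl[\Gamma_\zeta(x,y)-\Gamma_\xi(x,y)\bigr]^+\le\sum_{y\in S}\zeta(y)(1-\xi(y))\Gamma_\xi(x,y).$$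
   Context: $S=\mathbb{Z}^d$ and $\Omega=\{0,1\}^S$ with the product topology. For $\eta\in\Omega$ and $x,y\in S$, $\eta^{x,y}$ is the configuration obtained from $\eta$ by exchanging the values at $x$ and $y$. The jump rates $\Gamma_\eta(x,y)\ge 0$ may depend on the whole configuration $\eta$. They satisfy $$\sup_{v\in S}\sum_{u\in S}\sup_{\eta\in\Omega}\Gamma_\eta(u,v)<\infty,\qquad \sup_{u\in S}\sum_{v\in S}\sup_{\eta\in\Omega}\Gamma_\eta(u,v)<\infty,$$ and $\mathcal{L}$ (acting on cylinder functions, i.e. functions depending on finitely many coordinates) is assumed to be the infinitesimal generator of a well-defined Markov process on $\Omega$, with semigroup $(T(t))_{t\ge 0}$. $[a]^+=\max(a,0)$. Partial order: $\eta\le\xi$ iff $\eta(x)\le\xi(x)$ for all $x\in S$. Let $\mathcal{M}$ be the set of bounded, continuous, non-decreasing real functions on $\Omega$. For probability measures $\nu,\nu'$ on $\Omega$, $\nu\le\nu'$ means $\nu(f)\le\nu'(f)$ for all $f\in\mathcal{M}$. The process is monotone if $f\in\mathcal{M}$ implies $T(t)f\in\mathcal{M}$ for all $t\ge0$; equivalently, $\nu\le\nu'$ implies $\nu T(t)\le\nu' T(t)$ for all $t\ge 0$. *)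

theory Defs
  imports "HOL-Probability.Probability"
begin

text \<open>Sites of the lattice \<open>\<int>\<^sup>d\<close>, with \<open>d = CARD('d)\<close>. A configuration is Boolean valued,
  \<open>True\<close> standing for the value 1 (an occupied site). On \<open>'d config\<close> the library topology is the
  product topology and the library order is the coordinatewise one.\<close>

type_synonym 'd site = "int ^ 'd"
type_synonym 'd config = "'d site \<Rightarrow> bool"

type_synonym 'd rates = "'d config \<Rightarrow> 'd site \<Rightarrow> 'd site \<Rightarrow> real"

definition exchange :: "'d::finite config \<Rightarrow> 'd site \<Rightarrow> 'd site \<Rightarrow> 'd config" where
  "exchange \<eta> x y = \<eta>(x := \<eta> y, y := \<eta> x)"

definition cylinder :: "('d::finite config \<Rightarrow> real) \<Rightarrow> bool" where
  "cylinder f \<longleftrightarrow>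
     (\<exists>A. finite A \<and> (\<forall>\<eta> \<eta>'. (\<forall>x\<in>A. \<eta> x = \<eta>' x) \<longrightarrow> f \<eta> = f \<eta>'))"

text \<open>The sums in \<open>admissible_rates\<close> are taken in \<open>ennreal\<close>, so that they are meaningful without
  any summability assumption.\<close>

definition admissible_rates :: "'d::finite rates \<Rightarrow> bool" where
  "admissible_rates \<Gamma> \<longleftrightarrow>
     (\<forall>\<eta> x y. 0 \<le> \<Gamma> \<eta> x y) \<and>
     (SUP v. \<Sum>\<^sub>\<infinity>u. SUP \<eta>. ennreal (\<Gamma> \<eta> u v)) < \<infinity> \<and>
     (SUP u. \<Sum>\<^sub>\<infinity>v. SUP \<eta>. ennreal (\<Gamma> \<eta> u v)) < \<infinity>"

text \<open>For admissible rates and cylinder \<open>f\<close> the family below is absolutely summable.\<close>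

definition exclusion_op :: "'d::finite rates \<Rightarrow> ('d config \<Rightarrow> real) \<Rightarrow> 'd config \<Rightarrow> real" where
  "exclusion_op \<Gamma> f \<eta> =
     (\<Sum>\<^sub>\<infinity>(x, y). of_bool (\<eta> x) * (1 - of_bool (\<eta> y)) * \<Gamma> \<eta> x y * (f (exchange \<eta> x y) - f \<eta>))"

text \<open>A Markov process is given by its transition function: \<open>P t \<eta>\<close> is the law at time
  \<open>t \<ge> 0\<close> of the process started from \<open>\<eta>\<close>.\<close>

definition semigroup ::
    "(real \<Rightarrow> 'd::finite config \<Rightarrow> 'd config measure) \<Rightarrow>
     real \<Rightarrow> ('d config \<Rightarrow> real) \<Rightarrow> 'd config \<Rightarrow> real" where
  "semigroup P t f \<eta> = (LINT \<xi>|P t \<eta>. f \<xi>)"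

definition feller_process ::
    "(real \<Rightarrow> 'd::finite config \<Rightarrow> 'd config measure) \<Rightarrow> bool" where
  "feller_process P \<longleftrightarrow>
     (\<forall>t\<ge>0. P t \<in> borel \<rightarrow>\<^sub>M prob_algebra borel) \<and>
     (\<forall>\<eta>. P 0 \<eta> = return borel \<eta>) \<and>
     (\<forall>s\<ge>0. \<forall>t\<ge>0. \<forall>\<eta>. P (s + t) \<eta> = P s \<eta> \<bind> P t) \<and>
     (\<forall>t\<ge>0. \<forall>f. continuous_on UNIV f \<longrightarrow> continuous_on UNIV (semigroup P t f)) \<and>
     (\<forall>f. continuous_on UNIV f \<longrightarrow>
        uniform_limit UNIV (\<lambda>t. semigroup P t f) f (at_right 0))"

text \<open>The generator, as a graph in \<open>C(\<Omega>) \<times> C(\<Omega>)\<close>, for the supremum norm.\<close>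

definition generator ::
    "(real \<Rightarrow> 'd::finite config \<Rightarrow> 'd config measure) \<Rightarrow>
     (('d config \<Rightarrow> real) \<times> ('d config \<Rightarrow> real)) set" where
  "generator P = {(f, g). continuous_on UNIV f \<and> continuous_on UNIV g \<and>
     uniform_limit UNIV (\<lambda>t \<eta>. (semigroup P t f \<eta> - f \<eta>) / t) g (at_right 0)}"

text \<open>An operator given on cylinder functions only generates a process if its closure (in the
  supremum norm) is the generator of that process, i.e. cylinder functions form a core.\<close>

definition cylinder_closure ::
    "(('d::finite config \<Rightarrow> real) \<Rightarrow> 'd config \<Rightarrow> real) \<Rightarrow>
     (('d config \<Rightarrow> real) \<times> ('d config \<Rightarrow> real)) set" where
  "cylinder_closure L = {(f, g). \<exists>F :: nat \<Rightarrow> 'd config \<Rightarrow> real.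
     (\<forall>n. cylinder (F n)) \<and>
     uniform_limit UNIV F f sequentially \<and>
     uniform_limit UNIV (\<lambda>n. L (F n)) g sequentially}"

definition exclusion_process ::
    "'d::finite rates \<Rightarrow> (real \<Rightarrow> 'd config \<Rightarrow> 'd config measure) \<Rightarrow> bool" where
  "exclusion_process \<Gamma> P \<longleftrightarrow>
     feller_process P \<and> generator P = cylinder_closure (exclusion_op \<Gamma>)"

definition increasing_functions :: "('d::finite config \<Rightarrow> real) set" where
  "increasing_functions = {f. bounded (range f) \<and> continuous_on UNIV f \<and> mono f}"

definition monotone_process ::
    "(real \<Rightarrow> 'd::finite config \<Rightarrow> 'd config measure) \<Rightarrow> bool" where
  "monotone_process P \<longleftrightarrow>
     (\<forall>f\<in>increasing_functions. \<forall>t\<ge>0. semigroup P t f \<in> increasing_functions)"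

end

theory Submission
  imports Defs
begin

text \<open>Necessity: for an increasing cylinder function \<open>f\<close> and \<open>\<xi> \<le> \<zeta>\<close> with \<open>f \<xi> = f \<zeta>\<close>, differentiating
  \<open>T(t)f \<xi> \<le> T(t)f \<zeta>\<close> at \<open>t = 0\<close> gives \<open>Lf \<xi> \<le> Lf \<zeta>\<close>. Indicators of suitable increasing cylinder
  events turn this into condition (i), and particle-hole duality into condition (ii).

  Sufficiency: no coupled process is needed. If \<open>(\<xi>, \<zeta>)\<close> maximizes \<open>f \<xi> - f \<zeta>\<close> among ordered pairs,
  then (i) and (ii) imply \<open>Lf \<xi> \<le> Lf \<zeta>\<close>. Hence the largest order violation of \<open>f\<close> is at most
  that of \<open>f - \<epsilon>Lf\<close>, first for cylinder \<open>f\<close> and then on the closure. Since \<open>T(t)f\<close> is a limit of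
  implicit Euler steps, \<open>T(t)\<close> creates no order violation.\<close>

subsection \<open>Summability of the rates\<close>

lemma summable_on_dominated:
  fixes f :: "'a \<Rightarrow> real"
  assumes "g summable_on A" and "\<And>x. x \<in> A \<Longrightarrow> \<bar>f x\<bar> \<le> g x"
  shows "f summable_on A"
  by (rule abs_summable_summable, rule Infinite_Sum.abs_summable_on_comparison_test'[OF assms(1)]) (use assms(2) in auto)

text \<open>Transfers the \<open>ennreal\<close> bounds of \<open>admissible_rates\<close> to real
  summability: \<open>enn2real\<close> commutes with finite sums of finite terms, and these stay
  below the finite total.\<close>

lemma summable_on_enn2real:
  fixes h :: "'a \<Rightarrow> ennreal"
  assumes "infsum h UNIV < \<infinity>"
  shows "(\<lambda>x. enn2real (h x)) summable_on UNIV" and "h x < \<infinity>"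
proof -
  have le: "sum h F \<le> infsum h UNIV" if "finite F" for F
    using that infsum_mono_neutral[of h F h UNIV] by (simp add: nonneg_summable_on_complete)
  show fin: "h x < \<infinity>" for x
    using le[of "{x}"] assms by simp
  have "sum (\<lambda>x. enn2real (h x)) F \<le> enn2real (infsum h UNIV)" if "finite F" for F
  proof -
    have "sum (\<lambda>x. enn2real (h x)) F = enn2real (sum h F)"
      using fin by (simp add: enn2real_sum o_def)
    also have "\<dots> \<le> enn2real (infsum h UNIV)"
      using le[OF that] assms by (intro enn2real_mono) auto
    finally show ?thesis .
  qed
  then show "(\<lambda>x. enn2real (h x)) summable_on UNIV"
    by (intro nonneg_bdd_above_summable_on bdd_aboveI2) auto
qed

text \<open>A dominating rate uniform in the configuration. Since \<open>enn2real\<close> sends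
  infinity to 0, it is a true bound only once admissibility makes the supremum finite.\<close>

definition rate_bound :: "'d::finite rates \<Rightarrow> 'd site \<Rightarrow> 'd site \<Rightarrow> real" where
  "rate_bound \<Gamma> x y = enn2real (SUP \<eta>. ennreal (\<Gamma> \<eta> x y))"

lemma rate_nonneg: "admissible_rates \<Gamma> \<Longrightarrow> 0 \<le> \<Gamma> \<eta> x y"
  by (simp add: admissible_rates_def)

lemma rate_bound_nonneg: "0 \<le> rate_bound \<Gamma> x y"
  by (simp add: rate_bound_def)

lemma
  assumes "admissible_rates \<Gamma>"
  shows summable_rate_bound_source: "(\<lambda>x. rate_bound \<Gamma> x y) summable_on UNIV"
    and summable_rate_bound_target: "(\<lambda>y. rate_bound \<Gamma> x y) summable_on UNIV"
    and rate_le_bound: "\<Gamma> \<eta> x y \<le> rate_bound \<Gamma> x y"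
proof -
  have 1: "(\<Sum>\<^sub>\<infinity>x. SUP \<eta>. ennreal (\<Gamma> \<eta> x y)) < \<infinity>" for y
    using assms unfolding admissible_rates_def by (meson SUP_upper UNIV_I le_less_trans)
  have 2: "(\<Sum>\<^sub>\<infinity>y. SUP \<eta>. ennreal (\<Gamma> \<eta> x y)) < \<infinity>" for x
    using assms unfolding admissible_rates_def by (meson SUP_upper UNIV_I le_less_trans)
  show "(\<lambda>x. rate_bound \<Gamma> x y) summable_on UNIV"
    unfolding rate_bound_def by (rule summable_on_enn2real[OF 1])
  show "(\<lambda>y. rate_bound \<Gamma> x y) summable_on UNIV"
    unfolding rate_bound_def by (rule summable_on_enn2real[OF 2])
  have "enn2real (ennreal (\<Gamma> \<eta> x y)) \<le> rate_bound \<Gamma> x y"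
    unfolding rate_bound_def using summable_on_enn2real(2)[OF 1[of y], of x]
    by (intro enn2real_mono SUP_upper) auto
  then show "\<Gamma> \<eta> x y \<le> rate_bound \<Gamma> x y"
    using rate_nonneg[OF assms] by simp
qed

text \<open>The pairs touching \<open>A\<close> form a finite union of rows and columns, and each
  row and column is summable by admissibility.\<close>

lemma summable_rate_bound_near:
  fixes \<Gamma> :: "'d::finite rates"
  assumes "admissible_rates \<Gamma>" and "finite A"
  shows "(\<lambda>(x, y). of_bool (x \<in> A \<or> y \<in> A) * rate_bound \<Gamma> x y) summable_on UNIV"
proof -
  define K where "K = (\<lambda>(x, y). rate_bound \<Gamma> x y)"
  define B where "B F = F \<times> UNIV \<union> UNIV \<times> F" for F :: "'d site set"
  have col: "K summable_on {a} \<times> UNIV" for a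
  proof -
    have "{a} \<times> (UNIV :: 'd site set) = range (Pair a)" by auto
    moreover have "K summable_on range (Pair a)"
      using summable_on_reindex[of "Pair a" UNIV K] summable_rate_bound_target[OF assms(1), of a]
      by (simp add: K_def o_def inj_on_def)
    ultimately show ?thesis by (simp only:)
  qed
  have row: "K summable_on UNIV \<times> {a}" for a
  proof -
    have "UNIV \<times> {a} = range (\<lambda>x::'d site. (x, a))" by auto
    then show ?thesis
      using summable_on_reindex[of "\<lambda>x. (x, a)" UNIV K] summable_rate_bound_source[OF assms(1), of a]
      by (simp add: K_def o_def inj_on_def)
  qed
  have "K summable_on B A"
    using assms(2)
  proof induction
    case empty
    then show ?case by (simp add: B_def)
  next
    case (insert a F)
    \<comment> \<open>Overlaps are removed so that summability over disjoint unions applies.\<close>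
    have eq: "B (insert a F) = B F \<union> (({a} \<times> UNIV) \<union> (UNIV \<times> {a} - {a} \<times> UNIV) - B F)"
      by (auto simp: B_def)
    have "K summable_on ({a} \<times> UNIV) \<union> (UNIV \<times> {a} - {a} \<times> UNIV)"
      by (intro summable_on_Un_disjoint col summable_on_subset_banach[OF row]) auto
    then have "K summable_on ({a} \<times> UNIV) \<union> (UNIV \<times> {a} - {a} \<times> UNIV) - B F"
      by (rule summable_on_subset_banach) auto
    then show ?case
      using insert.IH unfolding eq by (intro summable_on_Un_disjoint) auto
  qed
  then show ?thesis
    by (subst summable_on_cong_neutral[where g = K and T = "B A"]) (auto simp: K_def B_def)
qed

section \<open>Cylinder functions and their increments\<close>

lemma exchange_unchanged: "x \<notin> A \<Longrightarrow> y \<notin> A \<Longrightarrow> z \<in> A \<Longrightarrow> exchange \<eta> x y z = \<eta> z"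
  by (auto simp: exchange_def)

text \<open>A cylinder function is determined by which of the finitely many sites of
  \<open>A\<close> are occupied.\<close>

lemma cylinder_finite_range:
  assumes "cylinder f"
  shows "finite (range f)"
proof -
  obtain A where A: "finite A" "\<And>\<eta> \<eta>'. (\<forall>x\<in>A. \<eta> x = \<eta>' x) \<Longrightarrow> f \<eta> = f \<eta>'"
    using assms unfolding cylinder_def by blast
  have "range f \<subseteq> (\<lambda>B. f (\<lambda>x. x \<in> B)) ` Pow A"
  proof safe
    fix \<eta>
    have "f \<eta> = f (\<lambda>x. x \<in> {x \<in> A. \<eta> x})" by (rule A) auto
    then show "f \<eta> \<in> (\<lambda>B. f (\<lambda>x. x \<in> B)) ` Pow A" by blast
  qed
  with A(1) show ?thesis by (meson finite_Pow_iff finite_imageI finite_subset)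
qed

text \<open>Only exchanges touching the finite support of \<open>f\<close> contribute, so that the rate bounds
  dominate all the sums below.\<close>

lemma summable_weighted_increments:
  assumes "admissible_rates \<Gamma>" and "cylinder f"
    and w: "\<And>x y. \<bar>w x y\<bar> \<le> rate_bound \<Gamma> x y"
  shows "(\<lambda>(x, y). w x y * (f (exchange \<eta> x y) - f \<eta>)) summable_on UNIV"
proof -
  obtain A where A: "finite A" "\<And>\<eta> \<eta>'. (\<forall>x\<in>A. \<eta> x = \<eta>' x) \<Longrightarrow> f \<eta> = f \<eta>'"
    using assms unfolding cylinder_def by blast
  obtain C where C: "\<bar>f \<eta>\<bar> \<le> C" for \<eta>
    using finite_imp_bounded[OF cylinder_finite_range[OF assms(2)]] by (auto simp: bounded_iff)
  have "\<bar>w x y * (f (exchange \<eta> x y) - f \<eta>)\<bar>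
      \<le> 2 * C * (of_bool (x \<in> A \<or> y \<in> A) * rate_bound \<Gamma> x y)" for x y
  proof (cases "x \<in> A \<or> y \<in> A")
    case True
    have "\<bar>f (exchange \<eta> x y) - f \<eta>\<bar> \<le> 2 * C"
      using C[of \<eta>] C[of "exchange \<eta> x y"] by linarith
    then show ?thesis
      using True mult_mono[OF w[of x y], of "\<bar>f (exchange \<eta> x y) - f \<eta>\<bar>" "2 * C"] rate_bound_nonneg[of \<Gamma> x y]
      by (simp add: abs_mult mult.commute)
  next
    case False
    then have "f (exchange \<eta> x y) = f \<eta>" by (intro A) (auto simp: exchange_unchanged)
    then show ?thesis using False by simp
  qed
  then show ?thesis
    by (intro summable_on_dominated[OF summable_on_cmult_right[OF
            summable_rate_bound_near[OF assms(1) A(1)]], of _ "2 * C"])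
      (auto simp: case_prod_unfold)
qed

text \<open>A number \<beta> >= 0 separates the values: \<open>a\<close> is at most \<beta> where
  \<open>w\<close> is nonzero, \<open>b\<close> is at least \<beta> where \<open>v\<close> is
  nonzero. Hence comparing total weights suffices, and no explicit matching of jumps is
  needed.\<close>

lemma weighted_infsum_le:
  fixes w v a b :: "'a \<Rightarrow> real"
  assumes w: "w summable_on UNIV" "\<And>x. 0 \<le> w x" and v: "v summable_on UNIV" "\<And>x. 0 \<le> v x"
    and wa: "(\<lambda>x. w x * a x) summable_on UNIV" and vb: "(\<lambda>x. v x * b x) summable_on UNIV"
    and le: "infsum w UNIV \<le> infsum v UNIV"
    and ab: "\<And>x x'. w x \<noteq> 0 \<Longrightarrow> v x' \<noteq> 0 \<Longrightarrow> a x \<le> b x'"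
    and b: "\<And>x. v x \<noteq> 0 \<Longrightarrow> 0 \<le> b x"
  shows "(\<Sum>\<^sub>\<infinity>x. w x * a x) \<le> (\<Sum>\<^sub>\<infinity>x. v x * b x)"
proof (cases "\<forall>x. v x = 0")
  \<comment> \<open>Treated apart because the infimum defining \<beta> would range over the empty
    set.\<close>
  case True
  then have "infsum v UNIV = 0" by (simp add: infsum_0)
  with le have "infsum w UNIV \<le> 0" by simp
  then have "w x = 0" for x using nonneg_infsum_le_0D[OF _ w(1)] w(2) by blast
  with True show ?thesis by simp
next
  case False
  define \<beta> where "\<beta> = Inf (b ` {x. v x \<noteq> 0})"
  have \<beta>0: "0 \<le> \<beta>" unfolding \<beta>_def using False b by (intro cInf_greatest) auto
  have b\<beta>: "\<beta> \<le> b x" if "v x \<noteq> 0" for x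
    unfolding \<beta>_def using that b by (intro cInf_lower bdd_belowI[of _ 0]) auto
  have a\<beta>: "a x \<le> \<beta>" if "w x \<noteq> 0" for x
    unfolding \<beta>_def using False ab[OF that] by (intro cInf_greatest) auto
  have "(\<Sum>\<^sub>\<infinity>x. w x * a x) \<le> (\<Sum>\<^sub>\<infinity>x. \<beta> * w x)"
  proof (intro infsum_mono wa summable_on_cmult_right w)
    show "w x * a x \<le> \<beta> * w x" for x
      using a\<beta>[of x] w(2)[of x] by (cases "w x = 0") (auto simp: mult.commute intro: mult_right_mono)
  qed
  also have "\<dots> \<le> \<beta> * infsum v UNIV"
    using le \<beta>0 by (simp add: infsum_cmult_right' mult_left_mono)
  also have "\<dots> = (\<Sum>\<^sub>\<infinity>x. \<beta> * v x)" by (simp add: infsum_cmult_right')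
  also have "\<dots> \<le> (\<Sum>\<^sub>\<infinity>x. v x * b x)"
  proof (intro infsum_mono vb summable_on_cmult_right v)
    show "\<beta> * v x \<le> v x * b x" for x
      using b\<beta>[of x] v(2)[of x] by (cases "v x = 0") (auto simp: mult.commute intro: mult_right_mono)
  qed
  finally show ?thesis .
qed

text \<open>The comparison is required only fibrewise, not termwise: (ii) controls total rates for a
  fixed source. The swapped version serves (i), where the target is fixed.\<close>

lemma infsum_pair_mono:
  fixes F G :: "'a \<times> 'b \<Rightarrow> real"
  assumes F: "F summable_on UNIV" and G: "G summable_on UNIV"
    and le: "\<And>x. (\<lambda>y. F (x, y)) summable_on UNIV \<Longrightarrow> (\<lambda>y. G (x, y)) summable_on UNIV \<Longrightarrow>
      (\<Sum>\<^sub>\<infinity>y. F (x, y)) \<le> (\<Sum>\<^sub>\<infinity>y. G (x, y))"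
  shows "infsum F UNIV \<le> infsum G UNIV"
proof -
  have *: "(\<lambda>y. H (x, y)) summable_on UNIV" "(\<lambda>x. \<Sum>\<^sub>\<infinity>y. H (x, y)) summable_on UNIV"
     "infsum H UNIV = (\<Sum>\<^sub>\<infinity>x. \<Sum>\<^sub>\<infinity>y. H (x, y))"
    if "H summable_on UNIV" for H :: "'a \<times> 'b \<Rightarrow> real" and x
  proof -
    have H: "H summable_on Sigma UNIV (\<lambda>_. UNIV)" using that by simp
    show s: "(\<lambda>y. H (x, y)) summable_on UNIV" for x
      using summable_on_SigmaD1[of "curry H" UNIV "\<lambda>_. UNIV" x] H by (simp add: curry_def)
    show "(\<lambda>x. \<Sum>\<^sub>\<infinity>y. H (x, y)) summable_on UNIV"
      by (rule summable_on_SigmaD[OF H s])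
    show "infsum H UNIV = (\<Sum>\<^sub>\<infinity>x. \<Sum>\<^sub>\<infinity>y. H (x, y))"
      using infsum_Sigma_banach[OF H] by simp
  qed
  show ?thesis
    unfolding *(3)[OF F] *(3)[OF G] by (intro infsum_mono * F G le)
qed

lemma infsum_pair_mono_swap:
  fixes F G :: "'a \<times> 'b \<Rightarrow> real"
  assumes F: "F summable_on UNIV" and G: "G summable_on UNIV"
    and le: "\<And>y. (\<lambda>x. F (x, y)) summable_on UNIV \<Longrightarrow> (\<lambda>x. G (x, y)) summable_on UNIV \<Longrightarrow>
      (\<Sum>\<^sub>\<infinity>x. F (x, y)) \<le> (\<Sum>\<^sub>\<infinity>x. G (x, y))"
  shows "infsum F UNIV \<le> infsum G UNIV"
proof -
  have b: "bij_betw prod.swap UNIV (UNIV :: ('a \<times> 'b) set)"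
    by simp
  show ?thesis
    using infsum_pair_mono[of "\<lambda>z. F (prod.swap z)" "\<lambda>z. G (prod.swap z)"] assms
    by (simp add: summable_on_reindex_bij_betw[OF b] infsum_reindex_bij_betw[OF b])
qed

subsection \<open>Maximum principle\<close>

text \<open>\<open>both\<close> collects the jumps that the two configurations can make together. The excess \<open>lower\<close> of
  \<open>\<xi>\<close> over \<open>\<zeta>\<close> is absorbed, target by target, by the jumps \<open>fill\<close> of \<open>\<zeta>\<close>-particles missing in
  \<open>\<xi>\<close>; the excess \<open>upper\<close> of \<open>\<zeta>\<close> over \<open>\<xi>\<close> is absorbed, source by source, by the jumps \<open>drain\<close> of
  \<open>\<xi>\<close> onto sites occupied in \<open>\<zeta>\<close> only.\<close>

lemma exclusion_op_le_at_maximum: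
  assumes adm: "admissible_rates \<Gamma>" and cyl: "cylinder f" and le: "\<xi> \<le> \<zeta>"
    and maximal: "\<And>\<xi>' \<zeta>'. \<xi>' \<le> \<zeta>' \<Longrightarrow> f \<xi>' - f \<zeta>' \<le> f \<xi> - f \<zeta>"
    and inflow: "\<And>y. \<not> \<zeta> y \<Longrightarrow>
      (\<Sum>\<^sub>\<infinity>x. of_bool (\<xi> x) * max (\<Gamma> \<xi> x y - \<Gamma> \<zeta> x y) 0)
        \<le> (\<Sum>\<^sub>\<infinity>x. of_bool (\<zeta> x) * (1 - of_bool (\<xi> x)) * \<Gamma> \<zeta> x y)"
    and outflow: "\<And>x. \<xi> x \<Longrightarrow>
      (\<Sum>\<^sub>\<infinity>y. (1 - of_bool (\<zeta> y)) * max (\<Gamma> \<zeta> x y - \<Gamma> \<xi> x y) 0)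
        \<le> (\<Sum>\<^sub>\<infinity>y. of_bool (\<zeta> y) * (1 - of_bool (\<xi> y)) * \<Gamma> \<xi> x y)"
  shows "exclusion_op \<Gamma> f \<xi> \<le> exclusion_op \<Gamma> f \<zeta>"
proof -
  define a where "a x y = f (exchange \<xi> x y) - f \<xi>" for x y
  define b where "b x y = f (exchange \<zeta> x y) - f \<zeta>" for x y
  define both where "both x y = of_bool (\<xi> x \<and> \<not> \<zeta> y) * min (\<Gamma> \<xi> x y) (\<Gamma> \<zeta> x y)" for x y
  define lower where "lower x y = of_bool (\<xi> x \<and> \<not> \<zeta> y) * max (\<Gamma> \<xi> x y - \<Gamma> \<zeta> x y) 0" for x y
  define upper where "upper x y = of_bool (\<xi> x \<and> \<not> \<zeta> y) * max (\<Gamma> \<zeta> x y - \<Gamma> \<xi> x y) 0" for x y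
  define fill where "fill x y = of_bool (\<zeta> x \<and> \<not> \<xi> x \<and> \<not> \<zeta> y) * \<Gamma> \<zeta> x y" for x y
  define drain where "drain x y = of_bool (\<xi> x \<and> \<not> \<xi> y \<and> \<zeta> y) * \<Gamma> \<xi> x y" for x y
  note weights = both_def lower_def upper_def fill_def drain_def
  have \<xi>\<zeta>: "\<zeta> x" if "\<xi> x" for x using le that by (auto simp: le_fun_def)
  \<comment> \<open>Maximality bounds increments whenever the jumps keep the pair ordered;
    \<open>a_nonpos\<close> and \<open>b_nonneg\<close> are the cases where only one configuration
    moves.\<close>
  have cross: "a x y \<le> b x' y'" if "exchange \<xi> x y \<le> exchange \<zeta> x' y'" for x y x' y'
    using maximal[OF that] by (simp add: a_def b_def)
  have a_nonpos: "a x y \<le> 0" if "exchange \<xi> x y \<le> \<zeta>" for x y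
    using maximal[OF that] by (simp add: a_def)
  have b_nonneg: "0 \<le> b x y" if "\<xi> \<le> exchange \<zeta> x y" for x y
    using maximal[OF that] by (simp add: b_def)
  have bounded: "\<bar>both x y\<bar> \<le> rate_bound \<Gamma> x y" "\<bar>lower x y\<bar> \<le> rate_bound \<Gamma> x y"
    "\<bar>upper x y\<bar> \<le> rate_bound \<Gamma> x y" "\<bar>fill x y\<bar> \<le> rate_bound \<Gamma> x y"
    "\<bar>drain x y\<bar> \<le> rate_bound \<Gamma> x y" for x y
    using rate_nonneg[OF adm, of \<xi> x y] rate_nonneg[OF adm, of \<zeta> x y]
      rate_le_bound[OF adm, of \<xi> x y] rate_le_bound[OF adm, of \<zeta> x y]
    by (auto simp: weights)
  have nonneg: "0 \<le> both x y" "0 \<le> lower x y" "0 \<le> upper x y" "0 \<le> fill x y" "0 \<le> drain x y" for x y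
    using rate_nonneg[OF adm] by (auto simp: weights)
  have sum_a: "(\<lambda>(x, y). w x y * a x y) summable_on UNIV"
    and sum_b: "(\<lambda>(x, y). w x y * b x y) summable_on UNIV"
    if "\<And>x y. \<bar>w x y\<bar> \<le> rate_bound \<Gamma> x y" for w
    unfolding a_def b_def by (rule summable_weighted_increments[OF adm cyl that])+
  have sum_in: "(\<lambda>x. w x y) summable_on UNIV" and sum_out: "(\<lambda>y. w x y) summable_on UNIV"
    if "\<And>x y. \<bar>w x y\<bar> \<le> rate_bound \<Gamma> x y" for w x y
    using that by (auto intro: summable_on_dominated[OF summable_rate_bound_source[OF adm]]
        summable_on_dominated[OF summable_rate_bound_target[OF adm]])

  \<comment> \<open>Targets empty in \<zeta> split the rate into minimum plus excess; targets
    occupied in \<zeta> only give \<open>drain\<close>.\<close>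
  have "exclusion_op \<Gamma> f \<xi> = (\<Sum>\<^sub>\<infinity>(x, y). both x y * a x y + lower x y * a x y + drain x y * a x y)"
    unfolding exclusion_op_def
    by (intro infsum_cong) (auto simp: weights a_def min_def max_def \<xi>\<zeta> algebra_simps)
  also have "\<dots> = (\<Sum>\<^sub>\<infinity>(x, y). both x y * a x y) + (\<Sum>\<^sub>\<infinity>(x, y). lower x y * a x y)
      + (\<Sum>\<^sub>\<infinity>(x, y). drain x y * a x y)"
    using sum_a[of both] sum_a[of lower] sum_a[of drain] bounded
    by (simp add: case_prod_unfold infsum_add summable_on_add)
  finally have L\<xi>: "exclusion_op \<Gamma> f \<xi> = \<dots>" .
  \<comment> \<open>Dually, sources occupied in \<xi> give minimum plus excess, and sources occupied
    in \<zeta> only give \<open>fill\<close>.\<close>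
  have "exclusion_op \<Gamma> f \<zeta> = (\<Sum>\<^sub>\<infinity>(x, y). both x y * b x y + fill x y * b x y + upper x y * b x y)"
    unfolding exclusion_op_def
    by (intro infsum_cong) (auto simp: weights b_def min_def max_def \<xi>\<zeta> algebra_simps)
  also have "\<dots> = (\<Sum>\<^sub>\<infinity>(x, y). both x y * b x y) + (\<Sum>\<^sub>\<infinity>(x, y). fill x y * b x y)
      + (\<Sum>\<^sub>\<infinity>(x, y). upper x y * b x y)"
    using sum_b[of both] sum_b[of fill] sum_b[of upper] bounded
    by (simp add: case_prod_unfold infsum_add summable_on_add)
  finally have L\<zeta>: "exclusion_op \<Gamma> f \<zeta> = \<dots>" .

  have "(\<Sum>\<^sub>\<infinity>(x, y). both x y * a x y) \<le> (\<Sum>\<^sub>\<infinity>(x, y). both x y * b x y)"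
  proof (rule infsum_mono[OF sum_a sum_b])
    show "(case z of (x, y) \<Rightarrow> both x y * a x y) \<le> (case z of (x, y) \<Rightarrow> both x y * b x y)" for z
    proof (cases z)
      case (Pair x y)
      have "a x y \<le> b x y" if "\<xi> x" "\<not> \<zeta> y"
        using that \<xi>\<zeta> by (intro cross) (auto simp: exchange_def le_fun_def)
      then show ?thesis
        using Pair nonneg(1)[of x y] by (cases "\<xi> x \<and> \<not> \<zeta> y") (auto intro: mult_left_mono simp: both_def)
    qed
  qed (use bounded in auto)
  moreover have "(\<Sum>\<^sub>\<infinity>(x, y). lower x y * a x y) \<le> (\<Sum>\<^sub>\<infinity>(x, y). fill x y * b x y)"
  proof (rule infsum_pair_mono_swap)
    fix y
    assume "(\<lambda>x. case (x, y) of (x, y) \<Rightarrow> lower x y * a x y) summable_on UNIV"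
      and "(\<lambda>x. case (x, y) of (x, y) \<Rightarrow> fill x y * b x y) summable_on UNIV"
    then have "(\<lambda>x. lower x y * a x y) summable_on UNIV" "(\<lambda>x. fill x y * b x y) summable_on UNIV"
      by simp_all
    then have "(\<Sum>\<^sub>\<infinity>x. lower x y * a x y) \<le> (\<Sum>\<^sub>\<infinity>x. fill x y * b x y)"
    proof (intro weighted_infsum_le nonneg)
      show "(\<Sum>\<^sub>\<infinity>x. lower x y) \<le> (\<Sum>\<^sub>\<infinity>x. fill x y)"
      proof (cases "\<zeta> y")
        case False
        have "(\<Sum>\<^sub>\<infinity>x. lower x y) = (\<Sum>\<^sub>\<infinity>x. of_bool (\<xi> x) * max (\<Gamma> \<xi> x y - \<Gamma> \<zeta> x y) 0)"
          using False by (auto simp: lower_def intro: infsum_cong)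
        also have "\<dots> \<le> (\<Sum>\<^sub>\<infinity>x. of_bool (\<zeta> x) * (1 - of_bool (\<xi> x)) * \<Gamma> \<zeta> x y)"
          using False by (rule inflow)
        also have "\<dots> = (\<Sum>\<^sub>\<infinity>x. fill x y)"
          using False by (auto simp: fill_def intro!: infsum_cong)
        finally show ?thesis .
      qed (simp add: lower_def fill_def)
      \<comment> \<open>The two sources may differ: \<zeta> only loses a particle absent from \<xi>,
        and both configurations gain \<open>y\<close>.\<close>
      show "a x y \<le> b x' y" if "lower x y \<noteq> 0" "fill x' y \<noteq> 0" for x x'
        using that \<xi>\<zeta> by (intro cross) (auto simp: lower_def fill_def exchange_def le_fun_def)
      show "0 \<le> b x y" if "fill x y \<noteq> 0" for x
        using that \<xi>\<zeta> by (intro b_nonneg) (auto simp: fill_def exchange_def le_fun_def)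
    qed (assumption | rule sum_in bounded)+
    then show "(\<Sum>\<^sub>\<infinity>x. case (x, y) of (x, y) \<Rightarrow> lower x y * a x y)
        \<le> (\<Sum>\<^sub>\<infinity>x. case (x, y) of (x, y) \<Rightarrow> fill x y * b x y)"
      by simp
  qed (use sum_a sum_b bounded in auto)
  \<comment> \<open>Signs are reversed because \<open>weighted_infsum_le\<close> needs nonnegative
    values on the absorbing side, and \<open>drain\<close> jumps can only decrease
    \<open>f\<close>.\<close>
  moreover have "(\<Sum>\<^sub>\<infinity>(x, y). upper x y * - b x y) \<le> (\<Sum>\<^sub>\<infinity>(x, y). drain x y * - a x y)"
  proof (rule infsum_pair_mono)
    fix x
    assume "(\<lambda>y. case (x, y) of (x, y) \<Rightarrow> upper x y * - b x y) summable_on UNIV"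
      and "(\<lambda>y. case (x, y) of (x, y) \<Rightarrow> drain x y * - a x y) summable_on UNIV"
    then have "(\<lambda>y. upper x y * - b x y) summable_on UNIV" "(\<lambda>y. drain x y * - a x y) summable_on UNIV"
      by simp_all
    then have "(\<Sum>\<^sub>\<infinity>y. upper x y * - b x y) \<le> (\<Sum>\<^sub>\<infinity>y. drain x y * - a x y)"
    proof (intro weighted_infsum_le nonneg)
      show "(\<Sum>\<^sub>\<infinity>y. upper x y) \<le> (\<Sum>\<^sub>\<infinity>y. drain x y)"
      proof (cases "\<xi> x")
        case True
        have "(\<Sum>\<^sub>\<infinity>y. upper x y) = (\<Sum>\<^sub>\<infinity>y. (1 - of_bool (\<zeta> y)) * max (\<Gamma> \<zeta> x y - \<Gamma> \<xi> x y) 0)"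
          using True by (auto simp: upper_def intro!: infsum_cong)
        also have "\<dots> \<le> (\<Sum>\<^sub>\<infinity>y. of_bool (\<zeta> y) * (1 - of_bool (\<xi> y)) * \<Gamma> \<xi> x y)"
          using True by (rule outflow)
        also have "\<dots> = (\<Sum>\<^sub>\<infinity>y. drain x y)"
          using True by (auto simp: drain_def intro!: infsum_cong)
        finally show ?thesis .
      qed (simp add: upper_def drain_def)
      show "- b x y \<le> - a x y'" if "upper x y \<noteq> 0" "drain x y' \<noteq> 0" for y y'
      proof -
        have "a x y' \<le> b x y"
          using that \<xi>\<zeta> by (intro cross) (auto simp: upper_def drain_def exchange_def le_fun_def)
        then show ?thesis by simp
      qed
      show "0 \<le> - a x y" if "drain x y \<noteq> 0" for y
      proof -
        have "a x y \<le> 0"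
          using that \<xi>\<zeta> by (intro a_nonpos) (auto simp: drain_def exchange_def le_fun_def)
        then show ?thesis by simp
      qed
    qed (assumption | rule sum_out bounded)+
    then show "(\<Sum>\<^sub>\<infinity>y. case (x, y) of (x, y) \<Rightarrow> upper x y * - b x y)
        \<le> (\<Sum>\<^sub>\<infinity>y. case (x, y) of (x, y) \<Rightarrow> drain x y * - a x y)"
      by simp
  qed (use sum_a[of "\<lambda>x y. - drain x y"] sum_b[of "\<lambda>x y. - upper x y"] bounded in auto)
  ultimately show ?thesis
    unfolding L\<xi> L\<zeta> by (simp add: case_prod_unfold infsum_uminus)
qed

text \<open>With finitely many values there are finitely many differences, so the maximum is
  attained.\<close>

lemma exists_maximal_ordered_pair:
  fixes f :: "'d::finite config \<Rightarrow> real"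
  assumes "finite (range f)"
  obtains \<xi> \<zeta> where "\<xi> \<le> \<zeta>" and "\<And>\<xi>' \<zeta>'. \<xi>' \<le> \<zeta>' \<Longrightarrow> f \<xi>' - f \<zeta>' \<le> f \<xi> - f \<zeta>"
proof -
  define V where "V = (\<lambda>(\<xi>, \<zeta>). f \<xi> - f \<zeta>) ` {(\<xi>, \<zeta>). \<xi> \<le> \<zeta>}"
  have "V \<subseteq> (\<lambda>(s, t). s - t) ` (range f \<times> range f)"
    unfolding V_def by force
  then have fin: "finite V" using assms by (meson finite_SigmaI finite_imageI finite_subset)
  moreover have ne: "V \<noteq> {}" unfolding V_def by auto
  ultimately have "Max V \<in> V" by (rule Max_in)
  then obtain \<xi> \<zeta> where \<xi>\<zeta>: "\<xi> \<le> \<zeta>" "f \<xi> - f \<zeta> = Max V" unfolding V_def by auto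
  have "f \<xi>' - f \<zeta>' \<le> Max V" if "\<xi>' \<le> \<zeta>'" for \<xi>' \<zeta>'
    using fin that by (intro Max_ge) (auto simp: V_def)
  with \<xi>\<zeta> that show ?thesis by metis
qed

definition coupling_conditions :: "'d::finite rates \<Rightarrow> bool" where
  "coupling_conditions \<Gamma> \<longleftrightarrow> (\<forall>\<xi> \<zeta>. \<xi> \<le> \<zeta> \<longrightarrow>
      (\<forall>y. \<not> \<zeta> y \<longrightarrow>
        (\<Sum>\<^sub>\<infinity>x. of_bool (\<xi> x) * max (\<Gamma> \<xi> x y - \<Gamma> \<zeta> x y) 0)
          \<le> (\<Sum>\<^sub>\<infinity>x. of_bool (\<zeta> x) * (1 - of_bool (\<xi> x)) * \<Gamma> \<zeta> x y)) \<and>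
      (\<forall>x. \<xi> x \<longrightarrow>
        (\<Sum>\<^sub>\<infinity>y. (1 - of_bool (\<zeta> y)) * max (\<Gamma> \<zeta> x y - \<Gamma> \<xi> x y) 0)
          \<le> (\<Sum>\<^sub>\<infinity>y. of_bool (\<zeta> y) * (1 - of_bool (\<xi> y)) * \<Gamma> \<xi> x y)))"

text \<open>At a maximizing pair the generator terms have the favourable sign, so dropping them
  bounds the maximal violation of \<open>f\<close> by that of
  \<open>f - \<epsilon>Lf\<close>.\<close>

lemma cylinder_maximum_principle:
  assumes adm: "admissible_rates \<Gamma>" and cyl: "cylinder f" and cond: "coupling_conditions \<Gamma>"
    and \<epsilon>: "0 \<le> \<epsilon>" and le: "\<xi> \<le> \<zeta>"
    and C: "\<And>\<xi> \<zeta>. \<xi> \<le> \<zeta> \<Longrightarrow>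
      (f \<xi> - \<epsilon> * exclusion_op \<Gamma> f \<xi>) - (f \<zeta> - \<epsilon> * exclusion_op \<Gamma> f \<zeta>) \<le> C"
  shows "f \<xi> - f \<zeta> \<le> C"
proof -
  obtain \<alpha> \<beta> where \<alpha>\<beta>: "\<alpha> \<le> \<beta>" and max: "\<And>\<xi>' \<zeta>'. \<xi>' \<le> \<zeta>' \<Longrightarrow> f \<xi>' - f \<zeta>' \<le> f \<alpha> - f \<beta>"
    using exists_maximal_ordered_pair[OF cylinder_finite_range[OF cyl]] by metis
  have "exclusion_op \<Gamma> f \<alpha> \<le> exclusion_op \<Gamma> f \<beta>"
    using cond \<alpha>\<beta> unfolding coupling_conditions_def
    by (intro exclusion_op_le_at_maximum[OF adm cyl \<alpha>\<beta> max]) blast+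
  then have "\<epsilon> * exclusion_op \<Gamma> f \<alpha> \<le> \<epsilon> * exclusion_op \<Gamma> f \<beta>"
    using \<epsilon> by (rule mult_left_mono)
  then show ?thesis using max[OF le] C[OF \<alpha>\<beta>] by linarith
qed

text \<open>Uniform approximation of \<open>f\<close> and \<open>g\<close> together extends the
  principle to the whole generator domain. This is needed because \<open>T(t)f\<close> is in general
  not a cylinder function.\<close>

lemma closure_maximum_principle:
  assumes adm: "admissible_rates \<Gamma>" and cond: "coupling_conditions \<Gamma>"
    and fg: "(f, g) \<in> cylinder_closure (exclusion_op \<Gamma>)"
    and \<epsilon>: "0 \<le> \<epsilon>" and le: "\<xi> \<le> \<zeta>"
    and C: "\<And>\<xi> \<zeta>. \<xi> \<le> \<zeta> \<Longrightarrow> (f \<xi> - \<epsilon> * g \<xi>) - (f \<zeta> - \<epsilon> * g \<zeta>) \<le> C"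
  shows "f \<xi> - f \<zeta> \<le> C"
proof (rule field_le_epsilon)
  fix \<delta> :: real assume "0 < \<delta>"
  obtain F where F: "\<And>n. cylinder (F n)" "uniform_limit UNIV F f sequentially"
    "uniform_limit UNIV (\<lambda>n. exclusion_op \<Gamma> (F n)) g sequentially"
    using fg unfolding cylinder_closure_def by auto
  \<comment> \<open>Replacing \<open>f\<close> and \<open>g\<close> by approximants costs
    \<open>2 * \<rho> + 2 * \<epsilon> * \<rho>\<close> in the bound, and returning to
    \<open>f\<close> costs another \<open>2 * \<rho>\<close>; the total is \<delta>.\<close>
  define \<rho> where "\<rho> = \<delta> / (4 + 2 * \<epsilon>)"
  have \<rho>: "0 < \<rho>" using \<open>0 < \<delta>\<close> \<epsilon> by (simp add: \<rho>_def)
  have "\<forall>\<^sub>F n in sequentially. (\<forall>\<eta>. dist (F n \<eta>) (f \<eta>) < \<rho>) \<and> (\<forall>\<eta>. dist (exclusion_op \<Gamma> (F n) \<eta>) (g \<eta>) < \<rho>)"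
    using F(2,3) \<rho> unfolding uniform_limit_iff by (auto intro: eventually_conj)
  then obtain n where n: "\<And>\<eta>. \<bar>F n \<eta> - f \<eta>\<bar> < \<rho>" "\<And>\<eta>. \<bar>exclusion_op \<Gamma> (F n) \<eta> - g \<eta>\<bar> < \<rho>"
    unfolding eventually_sequentially dist_real_def by blast
  have "F n \<xi> - F n \<zeta> \<le> C + 2 * \<rho> + 2 * \<epsilon> * \<rho>"
  proof (rule cylinder_maximum_principle[OF adm F(1) cond \<epsilon> le])
    fix \<xi> \<zeta> :: "'a config" assume "\<xi> \<le> \<zeta>"
    have "\<bar>\<epsilon> * exclusion_op \<Gamma> (F n) \<eta> - \<epsilon> * g \<eta>\<bar> \<le> \<epsilon> * \<rho>" for \<eta>
      using mult_left_mono[OF less_imp_le[OF n(2)] \<epsilon>, of \<eta>] \<epsilon> by (simp add: abs_mult flip: right_diff_distrib)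
    from this[of \<xi>] this[of \<zeta>] n(1)[of \<xi>] n(1)[of \<zeta>] C[OF \<open>\<xi> \<le> \<zeta>\<close>]
    show "(F n \<xi> - \<epsilon> * exclusion_op \<Gamma> (F n) \<xi>) - (F n \<zeta> - \<epsilon> * exclusion_op \<Gamma> (F n) \<zeta>)
        \<le> C + 2 * \<rho> + 2 * \<epsilon> * \<rho>"
      by linarith
  qed
  moreover have "4 * \<rho> + 2 * \<epsilon> * \<rho> = (4 + 2 * \<epsilon>) * \<rho>" by algebra
  moreover have "\<dots> = \<delta>" using \<epsilon> by (simp add: \<rho>_def)
  ultimately show "f \<xi> - f \<zeta> \<le> C + \<delta>"
    using n(1)[of \<xi>] n(1)[of \<zeta>] by linarith
qed

subsection \<open>From the generator to the semigroup\<close>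

lemma compact_config: "compact (UNIV :: 'd::finite config set)"
proof -
  have "compact_space (euclidean :: bool topology)"
    by (simp add: compact_space_def finite_imp_compact)
  then have "compact_space (product_topology (\<lambda>_::'d site. euclidean :: bool topology) UNIV)"
    by (simp add: compact_space_product_topology)
  then show ?thesis
    by (simp add: euclidean_product_topology compact_space_def compactin_euclidean_iff)
qed

lemma continuous_config_bounded:
  fixes f :: "'d::finite config \<Rightarrow> real"
  assumes "continuous_on UNIV f"
  obtains C where "0 \<le> C" "\<And>\<eta>. \<bar>f \<eta>\<bar> \<le> C"
proof -
  have "bounded (range f)"
    by (rule compact_imp_bounded[OF compact_continuous_image[OF assms compact_config]])
  then obtain C where "\<And>\<eta>. \<bar>f \<eta>\<bar> \<le> C" by (auto simp: bounded_iff)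
  with that[of "max C 0"] show ?thesis by (auto simp: le_max_iff_disj)
qed

section \<open>Semigroup and generator of a Feller process\<close>

context
  fixes P :: "real \<Rightarrow> 'd::finite config \<Rightarrow> 'd config measure"
  assumes P: "feller_process P"
begin

lemma prob_space_transition: "0 \<le> t \<Longrightarrow> prob_space (P t \<eta>)"
  and sets_transition: "0 \<le> t \<Longrightarrow> sets (P t \<eta>) = sets borel"
  using P measurable_space[of "P t" borel "prob_algebra borel" \<eta>]
  by (auto simp: feller_process_def space_prob_algebra)

lemma integrable_transition:
  assumes "0 \<le> t" and f: "continuous_on UNIV f"
  shows "integrable (P t \<eta>) (f :: 'd config \<Rightarrow> real)"
proof -
  interpret prob_space "P t \<eta>" using assms(1) by (rule prob_space_transition)
  have [measurable_cong]: "sets (P t \<eta>) = sets borel" using assms(1) by (rule sets_transition)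
  have [measurable]: "f \<in> borel_measurable borel" by (rule borel_measurable_continuous_onI[OF f])
  obtain C where "\<And>\<eta>. \<bar>f \<eta>\<bar> \<le> C" using continuous_config_bounded[OF f] by metis
  then show ?thesis by (intro integrable_const_bound[of _ C]) auto
qed

lemma continuous_semigroup:
  "0 \<le> t \<Longrightarrow> continuous_on UNIV f \<Longrightarrow> continuous_on UNIV (semigroup P t f)"
  using P by (simp add: feller_process_def)

lemma semigroup_diff:
  assumes "0 \<le> t" "continuous_on UNIV f" "continuous_on UNIV g"
  shows "semigroup P t (\<lambda>\<eta>. f \<eta> - g \<eta>) \<eta> = semigroup P t f \<eta> - semigroup P t g \<eta>"
  unfolding semigroup_def using assms by (simp add: integrable_transition)

lemma semigroup_scale: "semigroup P t (\<lambda>\<eta>. c * f \<eta>) \<eta> = c * semigroup P t f \<eta>"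
  unfolding semigroup_def by simp

lemma semigroup_bound:
  assumes t: "0 \<le> t" and f: "continuous_on UNIV f" and C: "\<And>\<eta>. \<bar>f \<eta>\<bar> \<le> C"
  shows "\<bar>semigroup P t f \<eta>\<bar> \<le> C"
proof -
  interpret prob_space "P t \<eta>" using t by (rule prob_space_transition)
  have "\<bar>semigroup P t f \<eta>\<bar> \<le> (LINT \<xi>|P t \<eta>. \<bar>f \<xi>\<bar>)"
    unfolding semigroup_def by (rule integral_abs_bound)
  also have "\<dots> \<le> (LINT \<xi>|P t \<eta>. C)"
    using t f C by (intro integral_mono integrable_transition continuous_intros) auto
  also have "\<dots> = C" by (simp add: prob_space)
  finally show ?thesis .
qed

lemma semigroup_0: "continuous_on UNIV f \<Longrightarrow> semigroup P 0 f = f"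
  using P borel_measurable_continuous_onI[of f]
  by (auto simp: feller_process_def semigroup_def integral_return)

lemma semigroup_add:
  assumes st: "0 \<le> s" "0 \<le> t" and f: "continuous_on UNIV f"
  shows "semigroup P (s + t) f = semigroup P s (semigroup P t f)"
proof
  fix \<eta>
  interpret prob_space "P s \<eta>" using st(1) by (rule prob_space_transition)
  obtain C where C: "\<And>\<eta>. \<bar>f \<eta>\<bar> \<le> C" using continuous_config_bounded[OF f] by metis
  have N: "P t \<in> P s \<eta> \<rightarrow>\<^sub>M subprob_algebra borel"
    using P st(2) measurable_cong_sets[OF sets_transition[OF st(1), of \<eta>] refl]
    by (auto simp: feller_process_def intro: measurable_prob_algebraD)
  have "semigroup P (s + t) f \<eta> = integral\<^sup>L (P s \<eta> \<bind> P t) f"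
    using P st by (simp add: feller_process_def semigroup_def)
  also have "\<dots> = (LINT \<xi>|P s \<eta>. integral\<^sup>L (P t \<xi>) f)"
    by (rule integral_bind[where K = borel and B' = 1, OF borel_measurable_continuous_onI[OF f] _ N])
      (use C prob_space.emeasure_space_1[OF prob_space_transition[OF st(2)]] in \<open>auto intro: finite_measure_axioms\<close>)
  finally show "semigroup P (s + t) f \<eta> = semigroup P s (semigroup P t f) \<eta>"
    by (simp add: semigroup_def)
qed

lemma generatorD:
  assumes "(f, g) \<in> generator P" and "0 < \<delta>"
  shows "\<forall>\<^sub>F t in at_right 0. \<forall>\<eta>. \<bar>(semigroup P t f \<eta> - f \<eta>) / t - g \<eta>\<bar> < \<delta>"
  using assms by (auto simp: generator_def uniform_limit_iff dist_real_def)

text \<open>\<open>T(s)\<close> commutes with \<open>T(t)\<close>, so the error of the difference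
  quotient for \<open>T(s)f\<close> is \<open>T(s)\<close> applied to the error for
  \<open>f\<close>, and contractivity keeps it uniformly small.\<close>

lemma generator_semigroup:
  assumes fg: "(f, g) \<in> generator P" and s: "0 \<le> s"
  shows "(semigroup P s f, semigroup P s g) \<in> generator P"
proof -
  have f: "continuous_on UNIV f" and g: "continuous_on UNIV g"
    using fg by (auto simp: generator_def)
  have "\<forall>\<^sub>F t in at_right 0. \<forall>\<eta>.
      \<bar>(semigroup P t (semigroup P s f) \<eta> - semigroup P s f \<eta>) / t - semigroup P s g \<eta>\<bar> < \<delta>"
    if "0 < \<delta>" for \<delta>
  proof -
    \<comment> \<open>Halving restores the strict inequality, as \<open>semigroup_bound\<close>
      yields only a weak one.\<close>
    have "0 < \<delta> / 2" using that by simp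
    from generatorD[OF fg this] eventually_at_right_less[of "0::real"] show ?thesis
    proof eventually_elim
      case (elim t)
      show ?case
      proof
        fix \<eta>
        let ?h = "\<lambda>\<eta>. 1 / t * (semigroup P t f \<eta> - f \<eta>) - g \<eta>"
        have "semigroup P t (semigroup P s f) = semigroup P s (semigroup P t f)"
          using semigroup_add[OF s _ f, of t] semigroup_add[OF _ s f, of t] elim(2)
          by (simp add: add.commute)
        moreover have "semigroup P s ?h \<eta> = semigroup P s (\<lambda>\<eta>. 1 / t * (semigroup P t f \<eta> - f \<eta>)) \<eta> - semigroup P s g \<eta>"
          using elim by (intro semigroup_diff s continuous_intros continuous_semigroup f g) auto
        ultimately have "(semigroup P t (semigroup P s f) \<eta> - semigroup P s f \<eta>) / t - semigroup P s g \<eta>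
            = semigroup P s ?h \<eta>"
          using s f elim(2) by (simp only: semigroup_scale) (simp add: semigroup_diff continuous_semigroup)
        moreover have "\<bar>semigroup P s ?h \<eta>\<bar> \<le> \<delta> / 2"
          using elim by (intro semigroup_bound s continuous_intros continuous_semigroup f g) (auto intro: less_imp_le)
        ultimately show "\<bar>(semigroup P t (semigroup P s f) \<eta> - semigroup P s f \<eta>) / t - semigroup P s g \<eta>\<bar> < \<delta>"
          using that by simp
      qed
    qed
  qed
  then show ?thesis
    using s f g by (simp add: generator_def uniform_limit_iff dist_real_def continuous_semigroup)
qed

text \<open>Implicit Euler: \<open>T((k+1)\<epsilon>)f - \<epsilon> L T((k+1)\<epsilon>)f\<close> differs from \<open>T(k\<epsilon>)f\<close> by
  \<open>T(k\<epsilon>)(T(\<epsilon>)f - f - \<epsilon> T(\<epsilon>)Lf)\<close>, which is \<open>o(\<epsilon>)\<close> uniformly in \<open>k\<close> by contractivity.\<close>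

lemma generator_order_preserving:
  assumes adm: "admissible_rates \<Gamma>" and cond: "coupling_conditions \<Gamma>"
    and gen: "generator P = cylinder_closure (exclusion_op \<Gamma>)"
    and fg: "(f, g) \<in> generator P" and "mono f" and t: "0 < t"
  shows "mono (semigroup P t f)"
proof (rule monoI, rule field_le_epsilon)
  fix \<xi> \<zeta> :: "'d config" and \<gamma> :: real
  assume "\<xi> \<le> \<zeta>" "0 < \<gamma>"
  have f: "continuous_on UNIV f" and g: "continuous_on UNIV g"
    using fg by (auto simp: generator_def)
  \<comment> \<open>There will be \<open>n\<close> steps of length \<open>t / n\<close>, each adding
    at most \<open>4 * (t / n) * \<delta>\<close> to the order violation; the total is
    \<gamma>.\<close>
  define \<delta> where "\<delta> = \<gamma> / (4 * t)"
  have \<delta>: "0 < \<delta>" using t \<open>0 < \<gamma>\<close> by (simp add: \<delta>_def)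
  have "uniform_limit UNIV (\<lambda>t. semigroup P t g) g (at_right 0)"
    using P g by (simp add: feller_process_def)
  then have "\<forall>\<^sub>F \<epsilon> in at_right 0. \<forall>\<eta>. \<bar>semigroup P \<epsilon> g \<eta> - g \<eta>\<bar> < \<delta>"
    using \<delta> by (simp add: uniform_limit_iff dist_real_def)
  with generatorD[OF fg \<delta>]
  have "\<forall>\<^sub>F \<epsilon> in at_right 0. (\<forall>\<eta>. \<bar>(semigroup P \<epsilon> f \<eta> - f \<eta>) / \<epsilon> - g \<eta>\<bar> < \<delta>) \<and>
      (\<forall>\<eta>. \<bar>semigroup P \<epsilon> g \<eta> - g \<eta>\<bar> < \<delta>)"
    by (rule eventually_conj)
  moreover have "filterlim (\<lambda>n. t / real n) (at_right 0) sequentially"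
    using t by real_asymp
  ultimately have "\<forall>\<^sub>F n in sequentially. (\<forall>\<eta>. \<bar>(semigroup P (t / real n) f \<eta> - f \<eta>) / (t / real n) - g \<eta>\<bar> < \<delta>) \<and>
      (\<forall>\<eta>. \<bar>semigroup P (t / real n) g \<eta> - g \<eta>\<bar> < \<delta>)"
    by (rule eventually_compose_filterlim)
  \<comment> \<open>\<open>n = 0\<close> must be excluded, since \<open>t / 0 = 0\<close> is not a
    step length.\<close>
  from eventually_conj[OF this eventually_gt_at_top[of 0]]
  obtain n :: nat where n: "0 < n"
    and n1: "\<And>\<eta>. \<bar>(semigroup P (t / real n) f \<eta> - f \<eta>) / (t / real n) - g \<eta>\<bar> < \<delta>"
    and n2: "\<And>\<eta>. \<bar>semigroup P (t / real n) g \<eta> - g \<eta>\<bar> < \<delta>"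
    by (metis (mono_tags, lifting) eventually_happens' sequentially_bot)
  define \<epsilon> where "\<epsilon> = t / real n"
  have \<epsilon>: "0 < \<epsilon>" using t n by (simp add: \<epsilon>_def)
  let ?T = "semigroup P"
  let ?r = "\<lambda>\<eta>. (?T \<epsilon> f \<eta> - f \<eta>) - \<epsilon> * ?T \<epsilon> g \<eta>"
  have r_cont: "continuous_on UNIV ?r"
    using \<epsilon> by (intro continuous_intros continuous_semigroup f g) auto
  have r_bound: "\<bar>?r \<eta>\<bar> \<le> 2 * \<epsilon> * \<delta>" for \<eta>
  proof -
    \<comment> \<open>Up to the factor \<epsilon>, the one-step error is the difference-quotient
      error minus the continuity error of \<open>T(\<epsilon>)g\<close>, each below
      \<delta>.\<close>
    let ?q = "((?T \<epsilon> f \<eta> - f \<eta>) / \<epsilon> - g \<eta>) - (?T \<epsilon> g \<eta> - g \<eta>)"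
    have "?r \<eta> = \<epsilon> * ?q"
      using \<epsilon> by (simp add: field_simps)
    then have "\<bar>?r \<eta>\<bar> = \<epsilon> * \<bar>?q\<bar>"
      using \<epsilon> by (simp only: abs_mult abs_of_pos)
    also have "\<dots> \<le> \<epsilon> * (2 * \<delta>)"
      using n1[of \<eta>] n2[of \<eta>] \<epsilon> unfolding \<epsilon>_def[symmetric] by (intro mult_left_mono) auto
    finally show ?thesis by simp
  qed
  \<comment> \<open>Each step adds the error bound \<open>2 * \<epsilon> * \<delta>\<close> twice,
    once at \<xi> and once at \<zeta>.\<close>
  have "?T (real k * \<epsilon>) f \<xi> - ?T (real k * \<epsilon>) f \<zeta> \<le> real k * (4 * \<epsilon> * \<delta>)" if "\<xi> \<le> \<zeta>" for k \<xi> \<zeta>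
    using that
  proof (induction k arbitrary: \<xi> \<zeta>)
    case 0
    then show ?case using \<open>mono f\<close> f by (simp add: semigroup_0 monoD)
  next
    case (Suc k)
    let ?s = "real k * \<epsilon>" and ?s' = "real (Suc k) * \<epsilon>"
    have s: "0 \<le> ?s" "0 \<le> ?s'" using \<epsilon> by auto
    have s': "?s' = ?s + \<epsilon>" by (simp add: algebra_simps)
    have step: "?T ?s' f \<eta> - \<epsilon> * ?T ?s' g \<eta> = ?T ?s f \<eta> + ?T ?s ?r \<eta>" for \<eta>
      using s(1) \<epsilon> f g unfolding s'
      by (simp add: semigroup_diff semigroup_scale semigroup_add continuous_semigroup
          continuous_on_diff continuous_on_mult_left)
    have gen': "(?T ?s' f, ?T ?s' g) \<in> cylinder_closure (exclusion_op \<Gamma>)"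
      using generator_semigroup[OF fg s(2)] gen by simp
    show ?case
    proof (rule closure_maximum_principle[OF adm cond gen' less_imp_le[OF \<epsilon>] Suc.prems])
      fix \<xi> \<zeta> :: "'d config" assume "\<xi> \<le> \<zeta>"
      from Suc.IH[OF this] semigroup_bound[OF s(1) r_cont r_bound, of \<xi>]
        semigroup_bound[OF s(1) r_cont r_bound, of \<zeta>]
      show "(?T ?s' f \<xi> - \<epsilon> * ?T ?s' g \<xi>) - (?T ?s' f \<zeta> - \<epsilon> * ?T ?s' g \<zeta>)
          \<le> real (Suc k) * (4 * \<epsilon> * \<delta>)"
        unfolding step by (simp add: algebra_simps)
    qed
  qed
  from this[OF \<open>\<xi> \<le> \<zeta>\<close>, of n] show "?T t f \<xi> \<le> ?T t f \<zeta> + \<gamma>"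
    using n t by (simp add: \<epsilon>_def \<delta>_def)
qed

end

section \<open>From cylinder functions to continuous increasing functions\<close>

lemma cylinder_in_closure: "cylinder f \<Longrightarrow> (f, L f) \<in> cylinder_closure L"
  unfolding cylinder_closure_def by (auto intro!: exI[of _ "\<lambda>_. f"] uniform_limit_const)

lemma exhaustion_by_finite_sets:
  obtains B :: "nat \<Rightarrow> 'd::finite site set"
  where "\<And>n. finite (B n)" and "\<And>x. \<forall>\<^sub>F n in sequentially. x \<in> B n"
proof -
  have "\<forall>\<^sub>F n in sequentially. x \<in> {x. to_nat x \<le> n}" for x :: "'d site"
    using eventually_ge_at_top[of "to_nat x"] by simp
  moreover have "finite {x :: 'd site. to_nat x \<le> n}" for n
    using finite_vimageI[of "{..n}" to_nat] by (simp add: vimage_def)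
  ultimately show ?thesis using that[of "\<lambda>n. {x. to_nat x \<le> n}"] by blast
qed

text \<open>The Euler argument needs \<open>f\<close> in the generator domain. A general increasing
  \<open>f\<close> is a bounded pointwise limit of increasing cylinder functions, and dominated
  convergence passes the order on to \<open>T(t)f\<close>.\<close>

lemma monotone_process_sufficient:
  assumes adm: "admissible_rates \<Gamma>" and cond: "coupling_conditions \<Gamma>"
    and proc: "exclusion_process \<Gamma> P"
  shows "monotone_process P"
  unfolding monotone_process_def
proof (intro ballI allI impI)
  fix f :: "'a config \<Rightarrow> real" and t :: real
  assume "f \<in> increasing_functions" and t: "0 \<le> t"
  then have f: "continuous_on UNIV f" and "mono f" by (auto simp: increasing_functions_def)
  have P: "feller_process P" and gen: "generator P = cylinder_closure (exclusion_op \<Gamma>)"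
    using proc by (auto simp: exclusion_process_def)
  obtain B :: "nat \<Rightarrow> 'a site set" where B: "\<And>n. finite (B n)" "\<And>x. \<forall>\<^sub>F n in sequentially. x \<in> B n"
    using exhaustion_by_finite_sets by blast
  \<comment> \<open>Emptying all sites outside \<open>B n\<close> is itself an increasing map, so
    \<open>F n\<close> stays increasing.\<close>
  define F where "F n \<eta> = f (\<lambda>x. \<eta> x \<and> x \<in> B n)" for n \<eta>
  have F_closure: "(F n, exclusion_op \<Gamma> (F n)) \<in> generator P" for n
  proof -
    have "cylinder (F n)"
      unfolding cylinder_def
    proof (intro exI[of _ "B n"] conjI allI impI B(1))
      fix \<eta> \<eta>' :: "'a config" assume "\<forall>x\<in>B n. \<eta> x = \<eta>' x"
      then have "(\<lambda>x. \<eta> x \<and> x \<in> B n) = (\<lambda>x. \<eta>' x \<and> x \<in> B n)" by auto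
      then show "F n \<eta> = F n \<eta>'" by (simp add: F_def)
    qed
    then show ?thesis unfolding gen by (rule cylinder_in_closure)
  qed
  have F_cont: "continuous_on UNIV (F n)" for n
    using F_closure[of n] by (simp add: generator_def)
  have F_mono: "mono (F n)" for n
    unfolding F_def by (rule monoI, rule monoD[OF \<open>mono f\<close>]) (auto simp: le_fun_def)
  have F_lim: "(\<lambda>n. F n \<eta>) \<longlonglongrightarrow> f \<eta>" for \<eta>
  proof -
    have "(\<lambda>n x. \<eta> x \<and> x \<in> B n) \<longlonglongrightarrow> \<eta>"
    proof -
      have "(\<lambda>n. \<eta> x \<and> x \<in> B n) \<longlonglongrightarrow> \<eta> x" for x
        by (rule tendsto_eventually) (use B(2)[of x] in \<open>auto elim: eventually_mono\<close>)
      then show ?thesis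
        using limitin_componentwise[where X = "\<lambda>_. euclidean" and I = UNIV
            and f = "\<lambda>n x. \<eta> x \<and> x \<in> B n" and l = \<eta> and F = sequentially]
        by (simp add: euclidean_product_topology)
    qed
    then show ?thesis
      unfolding F_def by (rule continuous_on_tendsto_compose[OF f]) auto
  qed
  obtain C where C: "\<And>\<eta>. \<bar>f \<eta>\<bar> \<le> C" using continuous_config_bounded[OF f] by metis
  have lim: "(\<lambda>n. semigroup P t (F n) \<eta>) \<longlonglongrightarrow> semigroup P t f \<eta>" for \<eta>
    unfolding semigroup_def
  proof (rule integral_dominated_convergence[where w = "\<lambda>_. C"])
    show "f \<in> borel_measurable (P t \<eta>)" "F n \<in> borel_measurable (P t \<eta>)" for n
      using integrable_transition[OF P t] f F_cont by auto
    show "integrable (P t \<eta>) (\<lambda>_. C)"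
      by (rule integrable_transition[OF P t]) simp
  qed (use F_lim C in \<open>auto simp: F_def\<close>)
  have "mono (semigroup P t f)"
  proof (cases "t = 0")
    case True
    then show ?thesis using semigroup_0[OF P f] \<open>mono f\<close> by simp
  next
    case False
    with t have "0 < t" by simp
    from generator_order_preserving[OF P adm cond gen F_closure F_mono this]
    have "semigroup P t (F n) \<xi> \<le> semigroup P t (F n) \<zeta>" if "\<xi> \<le> \<zeta>" for n \<xi> \<zeta>
      using that by (auto dest: monoD)
    then show ?thesis
      by (intro monoI LIMSEQ_le[OF lim lim]) auto
  qed
  moreover have "continuous_on UNIV (semigroup P t f)"
    by (rule continuous_semigroup[OF P t f])
  ultimately show "semigroup P t f \<in> increasing_functions"
    by (auto simp: increasing_functions_def intro: compact_imp_bounded compact_continuous_image compact_config)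
qed

subsection \<open>Necessity of the conditions\<close>

text \<open>Monotonicity in infinitesimal form. Equality of \<open>f\<close> at the two
  configurations is what lets the order of \<open>T(t)f\<close> pass to its derivative at time
  0.\<close>

definition generator_monotone :: "'d::finite rates \<Rightarrow> bool" where
  "generator_monotone \<Gamma> \<longleftrightarrow> (\<forall>f \<xi> \<zeta>. cylinder f \<longrightarrow> mono f \<longrightarrow> \<xi> \<le> \<zeta> \<longrightarrow> f \<xi> = f \<zeta> \<longrightarrow>
     exclusion_op \<Gamma> f \<xi> \<le> exclusion_op \<Gamma> f \<zeta>)"

lemma monotone_process_imp_generator_monotone:
  assumes proc: "exclusion_process \<Gamma> P" and mono: "monotone_process P"
  shows "generator_monotone \<Gamma>"
  unfolding generator_monotone_def
proof (intro allI impI)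
  fix f :: "'a config \<Rightarrow> real" and \<xi> \<zeta> :: "'a config"
  assume cyl: "cylinder f" and "mono f" and le: "\<xi> \<le> \<zeta>" and eq: "f \<xi> = f \<zeta>"
  have gen: "(f, exclusion_op \<Gamma> f) \<in> generator P"
    using proc cylinder_in_closure[OF cyl] by (auto simp: exclusion_process_def)
  then have "f \<in> increasing_functions"
    using \<open>mono f\<close> finite_imp_bounded[OF cylinder_finite_range[OF cyl]]
    by (simp add: increasing_functions_def generator_def)
  then have "mono (semigroup P t f)" if "0 \<le> t" for t
    using mono that unfolding monotone_process_def increasing_functions_def by blast
  then have "(semigroup P t f \<xi> - f \<xi>) / t \<le> (semigroup P t f \<zeta> - f \<zeta>) / t" if "0 < t" for t
    using that le eq by (simp add: divide_right_mono monoD)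
  then have "\<forall>\<^sub>F t in at_right 0. (semigroup P t f \<xi> - f \<xi>) / t \<le> (semigroup P t f \<zeta> - f \<zeta>) / t"
    using eventually_at_right_less[of "0::real"] by (auto elim: eventually_mono)
  moreover have "uniform_limit UNIV (\<lambda>t \<eta>. (semigroup P t f \<eta> - f \<eta>) / t) (exclusion_op \<Gamma> f) (at_right 0)"
    using gen by (simp add: generator_def)
  from tendsto_uniform_limitI[OF this UNIV_I]
  have "((\<lambda>t. (semigroup P t f \<eta> - f \<eta>) / t) \<longlongrightarrow> exclusion_op \<Gamma> f \<eta>) (at_right 0)" for \<eta> .
  ultimately show "exclusion_op \<Gamma> f \<xi> \<le> exclusion_op \<Gamma> f \<zeta>"
    by (intro tendsto_le[OF trivial_limit_at_right_real]) auto
qed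

text \<open>The increasing hull of \<open>{\<xi>\<^sup>x\<^sup>,\<^sup>y | x \<in> A}\<close>, cut off to the finite set \<open>A \<union> B\<close> of
  particles of \<open>\<xi>\<close>: it is entered from \<open>\<xi>\<close> by all jumps from \<open>A\<close> to \<open>y\<close>, and from \<open>\<zeta> \<ge> \<xi>\<close>
  only by jumps to \<open>y\<close> not starting in \<open>B\<close>.\<close>

definition arrival_test ::
    "'d::finite site set \<Rightarrow> 'd site set \<Rightarrow> 'd site \<Rightarrow> 'd config \<Rightarrow> real" where
  "arrival_test A B y \<eta> =
     of_bool (\<eta> y \<and> (\<forall>x\<in>B. \<eta> x) \<and> (\<forall>x\<in>A. \<forall>x'\<in>A. x \<noteq> x' \<longrightarrow> \<eta> x \<or> \<eta> x'))"

lemma mono_arrival_test: "mono (arrival_test A B y)"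
proof (rule monoI)
  fix \<eta> \<eta>' :: "'a config" assume "\<eta> \<le> \<eta>'"
  then have "\<eta> x \<Longrightarrow> \<eta>' x" for x by (auto simp: le_fun_def)
  then show "arrival_test A B y \<eta> \<le> arrival_test A B y \<eta>'"
    unfolding arrival_test_def of_bool_def by (smt (verit))
qed

lemma cylinder_arrival_test:
  assumes "finite A" "finite B"
  shows "cylinder (arrival_test A B y)"
  unfolding cylinder_def
proof (intro exI[of _ "insert y (A \<union> B)"] conjI allI impI)
  fix \<eta> \<eta>' :: "'a config" assume "\<forall>x\<in>insert y (A \<union> B). \<eta> x = \<eta>' x"
  then show "arrival_test A B y \<eta> = arrival_test A B y \<eta>'"
    by (simp add: arrival_test_def cong: ball_cong)
qed (use assms in auto)

text \<open>The test vanishes while \<open>y\<close> is empty, so the subtracted value is 0 and only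
  jumps into \<open>y\<close> contribute.\<close>

lemma exclusion_op_arrival_test:
  assumes "\<not> \<eta> y"
  shows "exclusion_op \<Gamma> (arrival_test A B y) \<eta> =
    (\<Sum>\<^sub>\<infinity>x. of_bool (\<eta> x) * \<Gamma> \<eta> x y * arrival_test A B y (exchange \<eta> x y))"
proof -
  let ?h = "\<lambda>(x, z). of_bool (\<eta> x) * (1 - of_bool (\<eta> z)) * \<Gamma> \<eta> x z *
    (arrival_test A B y (exchange \<eta> x z) - arrival_test A B y \<eta>)"
  have "exclusion_op \<Gamma> (arrival_test A B y) \<eta> = infsum ?h (range (\<lambda>x. (x, y)))"
    unfolding exclusion_op_def
  proof (rule infsum_cong_neutral)
    fix z :: "'a site \<times> 'a site" assume "z \<in> UNIV - range (\<lambda>x. (x, y))"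
    then have "snd z \<noteq> y" by (cases z) auto
    then show "?h z = 0"
      using assms by (auto simp: arrival_test_def exchange_def case_prod_unfold)
  qed auto
  also have "\<dots> = (\<Sum>\<^sub>\<infinity>x. of_bool (\<eta> x) * \<Gamma> \<eta> x y * arrival_test A B y (exchange \<eta> x y))"
    using assms by (subst infsum_reindex) (auto simp: inj_on_def o_def arrival_test_def)
  finally show ?thesis .
qed

text \<open>The arrival test is 0 at both configurations, so \<open>generator_monotone\<close>
  compares its entrance rates: at least the rates from \<open>A\<close> under \<xi>, at most those
  from outside \<open>B\<close> under \<zeta>. Adding the \<zeta>-rates from \<open>B\<close> to
  both sides gives the claim.\<close>

lemma arrival_rates_finite:
  assumes adm: "admissible_rates \<Gamma>" and mon: "generator_monotone \<Gamma>"
    and le: "\<xi> \<le> \<zeta>" and y: "\<not> \<zeta> y"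
    and fin: "finite A" "finite B" and disj: "A \<inter> B = {}"
    and occ: "\<And>x. x \<in> A \<union> B \<Longrightarrow> \<xi> x"
  shows "(\<Sum>x\<in>A. \<Gamma> \<xi> x y) + (\<Sum>x\<in>B. \<Gamma> \<zeta> x y) \<le> (\<Sum>\<^sub>\<infinity>x. of_bool (\<zeta> x) * \<Gamma> \<zeta> x y)"
proof -
  let ?f = "arrival_test A B y"
  have \<xi>\<zeta>: "\<zeta> x" if "\<xi> x" for x using le that by (auto simp: le_fun_def)
  then have y': "\<not> \<xi> y" using y by blast
  have f01: "0 \<le> ?f \<eta>" "?f \<eta> \<le> 1" for \<eta> by (auto simp: arrival_test_def)
  have dom: "(\<lambda>x. w x * \<Gamma> \<eta> x y) summable_on UNIV" if "\<And>x. \<bar>w x\<bar> \<le> 1" for w \<eta>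
  proof (rule summable_on_dominated[OF summable_rate_bound_source[OF adm]])
    show "\<bar>w x * \<Gamma> \<eta> x y\<bar> \<le> rate_bound \<Gamma> x y" for x
      using mult_mono[OF that[of x] rate_le_bound[OF adm, of \<eta> x y]] rate_nonneg[OF adm, of \<eta> x y]
      by (simp add: abs_mult)
  qed
  have jumps: "(\<lambda>x. of_bool (\<eta> x) * \<Gamma> \<eta> x y * ?f (exchange \<eta> x y)) summable_on UNIV" for \<eta>
    using dom[of "\<lambda>x. of_bool (\<eta> x) * ?f (exchange \<eta> x y)" \<eta>] f01
    by (simp add: mult_ac abs_mult)
  have "(\<Sum>x\<in>A. \<Gamma> \<xi> x y) = (\<Sum>x\<in>A. of_bool (\<xi> x) * \<Gamma> \<xi> x y * ?f (exchange \<xi> x y))"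
    using occ disj y' by (intro sum.cong) (auto simp: arrival_test_def exchange_def)
  also have "\<dots> \<le> (\<Sum>\<^sub>\<infinity>x. of_bool (\<xi> x) * \<Gamma> \<xi> x y * ?f (exchange \<xi> x y))"
    using rate_nonneg[OF adm] f01 by (intro finite_sum_le_infsum jumps fin) auto
  also have "\<dots> = exclusion_op \<Gamma> ?f \<xi>"
    using y' by (rule exclusion_op_arrival_test[symmetric])
  also have "\<dots> \<le> exclusion_op \<Gamma> ?f \<zeta>"
    by (intro mon[unfolded generator_monotone_def, rule_format] cylinder_arrival_test
        mono_arrival_test fin le) (simp add: arrival_test_def y y')
  also have "\<dots> = (\<Sum>\<^sub>\<infinity>x. of_bool (\<zeta> x) * \<Gamma> \<zeta> x y * ?f (exchange \<zeta> x y))"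
    using y by (rule exclusion_op_arrival_test)
  also have "\<dots> \<le> (\<Sum>\<^sub>\<infinity>x. of_bool (\<zeta> x \<and> x \<notin> B) * \<Gamma> \<zeta> x y)"
  proof (intro infsum_mono jumps dom)
    fix x
    have "?f (exchange \<zeta> x y) = 0" if "x \<in> B"
    proof -
      have "x \<noteq> y" using that occ y' by blast
      then have "\<not> exchange \<zeta> x y x" using y by (simp add: exchange_def)
      then show ?thesis using that by (auto simp: arrival_test_def)
    qed
    moreover have "\<Gamma> \<zeta> x y * ?f (exchange \<zeta> x y) \<le> \<Gamma> \<zeta> x y"
      using mult_left_mono[OF f01(2) rate_nonneg[OF adm]] by simp
    ultimately show "of_bool (\<zeta> x) * \<Gamma> \<zeta> x y * ?f (exchange \<zeta> x y)
        \<le> of_bool (\<zeta> x \<and> x \<notin> B) * \<Gamma> \<zeta> x y"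
      by auto
  qed auto
  finally have "(\<Sum>x\<in>A. \<Gamma> \<xi> x y) \<le> \<dots>" .
  moreover have "(\<Sum>\<^sub>\<infinity>x. of_bool (x \<in> B) * \<Gamma> \<zeta> x y) = infsum (\<lambda>x. \<Gamma> \<zeta> x y) B"
    by (rule infsum_cong_neutral) auto
  moreover have "(\<Sum>\<^sub>\<infinity>x. of_bool (\<zeta> x \<and> x \<notin> B) * \<Gamma> \<zeta> x y) + (\<Sum>\<^sub>\<infinity>x. of_bool (x \<in> B) * \<Gamma> \<zeta> x y)
      = (\<Sum>\<^sub>\<infinity>x. of_bool (\<zeta> x \<and> x \<notin> B) * \<Gamma> \<zeta> x y + of_bool (x \<in> B) * \<Gamma> \<zeta> x y)"
    by (intro infsum_add[symmetric] dom) auto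
  moreover have "\<dots> = (\<Sum>\<^sub>\<infinity>x. of_bool (\<zeta> x) * \<Gamma> \<zeta> x y)"
    using occ \<xi>\<zeta> by (intro infsum_cong) auto
  ultimately show ?thesis using fin by simp
qed

text \<open>Adding the \<zeta>-rates of all \<xi>-particles to both sides turns the positive part
  into a maximum of the two rates, which is bounded through finite partial sums.\<close>

lemma inflow_condition_necessary:
  assumes adm: "admissible_rates \<Gamma>" and mon: "generator_monotone \<Gamma>"
    and le: "\<xi> \<le> \<zeta>" and y: "\<not> \<zeta> y"
  shows "(\<Sum>\<^sub>\<infinity>x. of_bool (\<xi> x) * max (\<Gamma> \<xi> x y - \<Gamma> \<zeta> x y) 0)
    \<le> (\<Sum>\<^sub>\<infinity>x. of_bool (\<zeta> x) * (1 - of_bool (\<xi> x)) * \<Gamma> \<zeta> x y)"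
proof -
  have \<xi>\<zeta>: "\<zeta> x" if "\<xi> x" for x using le that by (auto simp: le_fun_def)
  have dom: "g summable_on UNIV" if "\<And>x. 0 \<le> g x \<and> (g x \<le> \<Gamma> \<xi> x y \<or> g x \<le> \<Gamma> \<zeta> x y)" for g
    using that rate_le_bound[OF adm, of \<xi> _ y] rate_le_bound[OF adm, of \<zeta> _ y]
    by (intro summable_on_dominated[OF summable_rate_bound_source[OF adm, of y]]) (smt (verit))
  have nn: "0 \<le> \<Gamma> \<xi> x y" "0 \<le> \<Gamma> \<zeta> x y" for x using rate_nonneg[OF adm] by auto
  have s: "(\<lambda>x. of_bool (\<xi> x) * max (\<Gamma> \<xi> x y - \<Gamma> \<zeta> x y) 0) summable_on UNIV"
    "(\<lambda>x. of_bool (\<xi> x) * \<Gamma> \<zeta> x y) summable_on UNIV"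
    "(\<lambda>x. of_bool (\<zeta> x) * (1 - of_bool (\<xi> x)) * \<Gamma> \<zeta> x y) summable_on UNIV"
    "(\<lambda>x. of_bool (\<xi> x) * max (\<Gamma> \<xi> x y) (\<Gamma> \<zeta> x y)) summable_on UNIV"
    using nn by (intro dom; auto simp: max_def)+
  have "(\<Sum>\<^sub>\<infinity>x. of_bool (\<xi> x) * max (\<Gamma> \<xi> x y) (\<Gamma> \<zeta> x y)) \<le> (\<Sum>\<^sub>\<infinity>x. of_bool (\<zeta> x) * \<Gamma> \<zeta> x y)"
  proof (rule infsum_le_finite_sums[OF s(4)])
    fix F :: "'a site set" assume F: "finite F"
    \<comment> \<open>Splitting by the larger rate makes the two sums in
      \<open>arrival_rates_finite\<close> add up to the sum of maxima.\<close>
    define A where "A = {x \<in> F. \<xi> x \<and> \<Gamma> \<zeta> x y < \<Gamma> \<xi> x y}"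
    define B where "B = {x \<in> F. \<xi> x \<and> \<not> \<Gamma> \<zeta> x y < \<Gamma> \<xi> x y}"
    have "(\<Sum>x\<in>F. of_bool (\<xi> x) * max (\<Gamma> \<xi> x y) (\<Gamma> \<zeta> x y))
        = (\<Sum>x\<in>F. (if x \<in> A then \<Gamma> \<xi> x y else 0) + (if x \<in> B then \<Gamma> \<zeta> x y else 0))"
      by (intro sum.cong) (auto simp: A_def B_def)
    also have "\<dots> = (\<Sum>x\<in>A. \<Gamma> \<xi> x y) + (\<Sum>x\<in>B. \<Gamma> \<zeta> x y)"
    proof -
      have "F \<inter> A = A" "F \<inter> B = B" by (auto simp: A_def B_def)
      then show ?thesis using F by (simp add: sum.distrib flip: sum.inter_restrict)
    qed
    also have "\<dots> \<le> (\<Sum>\<^sub>\<infinity>x. of_bool (\<zeta> x) * \<Gamma> \<zeta> x y)"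
      using F by (intro arrival_rates_finite[OF adm mon le y]) (auto simp: A_def B_def)
    finally show "(\<Sum>x\<in>F. of_bool (\<xi> x) * max (\<Gamma> \<xi> x y) (\<Gamma> \<zeta> x y))
      \<le> (\<Sum>\<^sub>\<infinity>x. of_bool (\<zeta> x) * \<Gamma> \<zeta> x y)" .
  qed
  moreover have "(\<Sum>\<^sub>\<infinity>x. of_bool (\<xi> x) * max (\<Gamma> \<xi> x y) (\<Gamma> \<zeta> x y)) =
      (\<Sum>\<^sub>\<infinity>x. of_bool (\<xi> x) * max (\<Gamma> \<xi> x y - \<Gamma> \<zeta> x y) 0) + (\<Sum>\<^sub>\<infinity>x. of_bool (\<xi> x) * \<Gamma> \<zeta> x y)"
    unfolding infsum_add[OF s(1,2), symmetric] by (intro infsum_cong) (auto simp: max_def)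
  moreover have "(\<Sum>\<^sub>\<infinity>x. of_bool (\<zeta> x) * \<Gamma> \<zeta> x y) =
      (\<Sum>\<^sub>\<infinity>x. of_bool (\<zeta> x) * (1 - of_bool (\<xi> x)) * \<Gamma> \<zeta> x y) + (\<Sum>\<^sub>\<infinity>x. of_bool (\<xi> x) * \<Gamma> \<zeta> x y)"
    unfolding infsum_add[OF s(3,2), symmetric] by (intro infsum_cong) (auto simp: \<xi>\<zeta>)
  ultimately show ?thesis by linarith
qed

text \<open>Particle-hole duality: it exchanges the two conditions.\<close>

definition hole_rates :: "'d::finite rates \<Rightarrow> 'd rates" where
  "hole_rates \<Gamma> \<eta> x y = \<Gamma> (- \<eta>) y x"

lemma exchange_uminus: "exchange (- \<eta>) x y = - exchange \<eta> y x"
  by (rule ext) (auto simp: exchange_def)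

text \<open>Complementation permutes the configurations, so suprema are unchanged and the two
  summability bounds trade places.\<close>

lemma admissible_hole_rates:
  assumes "admissible_rates \<Gamma>"
  shows "admissible_rates (hole_rates \<Gamma>)"
proof -
  have "(SUP \<eta>. ennreal (\<Gamma> (- \<eta>) x y)) = (SUP \<eta>. ennreal (\<Gamma> \<eta> x y))" for x y
  proof -
    have "surj (uminus :: 'a config \<Rightarrow> 'a config)"
      by (rule surjI[of _ uminus]) simp
    then have "range (\<lambda>\<eta>. ennreal (\<Gamma> (- \<eta>) x y)) = range (\<lambda>\<eta>. ennreal (\<Gamma> \<eta> x y))"
      using image_image[of "\<lambda>\<eta>. ennreal (\<Gamma> \<eta> x y)" uminus UNIV] by simp
    then show ?thesis by simp
  qed
  with assms show ?thesis by (simp add: admissible_rates_def hole_rates_def)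
qed

text \<open>A particle jump of \<eta> from \<open>x\<close> to \<open>y\<close> is a jump of the
  complement from \<open>y\<close> to \<open>x\<close>. The outer minus signs make the transformed
  function increasing when \<open>f\<close> is.\<close>

lemma exclusion_op_hole_rates:
  "exclusion_op (hole_rates \<Gamma>) f \<eta> = - exclusion_op \<Gamma> (\<lambda>\<sigma>. - f (- \<sigma>)) (- \<eta>)"
proof -
  have b: "bij_betw prod.swap UNIV (UNIV :: ('a site \<times> 'a site) set)"
    by simp
  show ?thesis
    unfolding exclusion_op_def infsum_uminus[symmetric]
    by (subst infsum_reindex_bij_betw[OF b, symmetric])
      (auto simp: hole_rates_def exchange_uminus case_prod_unfold algebra_simps intro!: infsum_cong)
qed

lemma generator_monotone_hole_rates:
  assumes "generator_monotone \<Gamma>"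
  shows "generator_monotone (hole_rates \<Gamma>)"
  unfolding generator_monotone_def
proof (intro allI impI)
  fix f :: "'a config \<Rightarrow> real" and \<xi> \<zeta> :: "'a config"
  assume cyl: "cylinder f" and "mono f" and le: "\<xi> \<le> \<zeta>" and eq: "f \<xi> = f \<zeta>"
  obtain A where A: "finite A" "\<And>\<eta> \<eta>'. (\<forall>x\<in>A. \<eta> x = \<eta>' x) \<Longrightarrow> f \<eta> = f \<eta>'"
    using cyl unfolding cylinder_def by blast
  have "cylinder (\<lambda>\<sigma>. - f (- \<sigma>))"
    unfolding cylinder_def
  proof (intro exI[of _ A] conjI A(1) allI impI)
    fix \<eta> \<eta>' :: "'a config" assume "\<forall>x\<in>A. \<eta> x = \<eta>' x"
    then have "f (- \<eta>) = f (- \<eta>')" by (intro A(2)) simp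
    then show "- f (- \<eta>) = - f (- \<eta>')" by simp
  qed
  moreover have "mono (\<lambda>\<sigma>. - f (- \<sigma>))"
    using \<open>mono f\<close> by (intro monoI) (simp add: monoD)
  ultimately have "exclusion_op \<Gamma> (\<lambda>\<sigma>. - f (- \<sigma>)) (- \<zeta>) \<le> exclusion_op \<Gamma> (\<lambda>\<sigma>. - f (- \<sigma>)) (- \<xi>)"
    using assms le eq unfolding generator_monotone_def by simp
  then show "exclusion_op (hole_rates \<Gamma>) f \<xi> \<le> exclusion_op (hole_rates \<Gamma>) f \<zeta>"
    by (simp add: exclusion_op_hole_rates)
qed

lemma coupling_conditions_necessary:
  assumes adm: "admissible_rates \<Gamma>" and mon: "generator_monotone \<Gamma>"
  shows "coupling_conditions \<Gamma>"
  unfolding coupling_conditions_def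
proof (intro allI impI conjI)
  fix \<xi> \<zeta> :: "'a config" and x assume le: "\<xi> \<le> \<zeta>" and "\<xi> x"
  then show "(\<Sum>\<^sub>\<infinity>y. (1 - of_bool (\<zeta> y)) * max (\<Gamma> \<zeta> x y - \<Gamma> \<xi> x y) 0)
      \<le> (\<Sum>\<^sub>\<infinity>y. of_bool (\<zeta> y) * (1 - of_bool (\<xi> y)) * \<Gamma> \<xi> x y)"
    \<comment> \<open>Complementing reverses the order of the pair, and \<open>x\<close>, occupied
      in \<xi>, becomes an empty target in the larger configuration.\<close>
    using inflow_condition_necessary[OF admissible_hole_rates[OF adm] generator_monotone_hole_rates[OF mon],
        of "- \<zeta>" "- \<xi>" x]
    by (simp add: hole_rates_def of_bool_not_iff mult_ac)
qed (rule inflow_condition_necessary[OF adm mon])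

theorem theorem2:
  fixes \<Gamma> :: "'d::finite rates"
    and P :: "real \<Rightarrow> 'd config \<Rightarrow> 'd config measure"
  assumes "admissible_rates \<Gamma>"
    and "exclusion_process \<Gamma> P"
  shows "monotone_process P \<longleftrightarrow>
    (\<forall>\<xi> \<zeta>. \<xi> \<le> \<zeta> \<longrightarrow>
      (\<forall>y. \<not> \<zeta> y \<longrightarrow>
        (\<Sum>\<^sub>\<infinity>x. of_bool (\<xi> x) * max (\<Gamma> \<xi> x y - \<Gamma> \<zeta> x y) 0)
          \<le> (\<Sum>\<^sub>\<infinity>x. of_bool (\<zeta> x) * (1 - of_bool (\<xi> x)) * \<Gamma> \<zeta> x y)) \<and>
      (\<forall>x. \<xi> x \<longrightarrow>
        (\<Sum>\<^sub>\<infinity>y. (1 - of_bool (\<zeta> y)) * max (\<Gamma> \<zeta> x y - \<Gamma> \<xi> x y) 0)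
          \<le> (\<Sum>\<^sub>\<infinity>y. of_bool (\<zeta> y) * (1 - of_bool (\<xi> y)) * \<Gamma> \<xi> x y)))"
  unfolding coupling_conditions_def[symmetric]
  using assms monotone_process_imp_generator_monotone coupling_conditions_necessary
    monotone_process_sufficient by blast

end
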